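(* Let $n\ge1$, let $\vec x=(x_1,\dots,x_n)$, $\vec y=(y_1,\dots,y_n)$ be vectors in $\mathbb C^n$, and put $x_0=\frac1n\sum_{k=1}^nx_k$, $y_0=\frac1n\sum_{k=1}^ny_k$. If $\vec x$ is non-constant, then the affine deviation of $\vec x$ from $\vec y$ is $$d(\mathbb C^*\vec x+\mathbb C,\vec y)=\sqrt{\|\vec y-y_0\|^2-\frac{|\langle\vec x-x_0|\vec y-y_0\rangle|^2}{\|\vec x-x_0\|^2}}=d(a(\vec x-x_0),\vec y-y_0),$$ where $a=\dfrac{\overline{\langle\vec x-x_0|\vec y-y_0\rangle}}{\|\vec x-x_0\|^2}$. If $\vec x$ is a constant vector, then $d(\mathbb C^*\vec x+\mathbb C,\vec y)=\|\vec y-y_0\|$.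
   Context: $\mathbb C^*=\mathbb C\setminus\{0\}$. A vector $\vec x\in\mathbb C^n$ is constant if $x_1=\dots=x_n$. For $\vec x,\vec y\in\mathbb C^n$: $\langle\vec x|\vec y\rangle=\sum_{k=1}^nx_k\overline{y_k}$, $\|\vec x\|=\sqrt{\langle\vec x|\vec x\rangle}$, $d(\vec x,\vec y)=\|\vec x-\vec y\|$. For $z\in\mathbb C$, $\vec x+z=(x_1+z,\dots,x_n+z)$ and $\vec x-z=\vec x+(-z)$. The affine deviation is $d(\mathbb C^*\vec x+\mathbb C,\vec y)=\inf\{d(a\vec x+b,\vec y):a\in\mathbb C^*,\ b\in\mathbb C\}$. *)

theory Defs
  imports "HOL-Analysis.Analysis"
begin

text \<open>
  Vectors in complex n-space are elements of \<open>complex ^ 'n\<close>, with n being \<open>CARD('n)\<close>.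
  The library's \<^const>\<open>norm\<close> and \<^const>\<open>dist\<close> on this type are the Euclidean norm and
  distance, \<open>a *s x\<close> is scalar multiplication by a complex number, and \<open>vec z\<close> is the
  vector all of whose coordinates are \<open>z\<close>, so that \<open>x + vec z\<close> is the translate of \<open>x\<close>
  by the number \<open>z\<close>.
\<close>

definition is_constant :: "complex ^ 'n \<Rightarrow> bool" where
  "is_constant x \<longleftrightarrow> (\<forall>i j. x $ i = x $ j)"

text \<open>
  The library's inner product \<open>\<bullet>\<close> on \<open>complex ^ 'n\<close> is real-valued (the real part of the
  form below), so the Hermitian form is introduced separately. It is linear in the first
  argument.
\<close>

definition hermitian_inner :: "complex ^ 'n \<Rightarrow> complex ^ 'n \<Rightarrow> complex" where
  "hermitian_inner x y = (\<Sum>k\<in>UNIV. x $ k * cnj (y $ k))"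

lemma norm_eq_sqrt_hermitian_inner:
  fixes x :: "complex ^ 'n"
  shows "norm x = sqrt (Re (hermitian_inner x x))"
    and "Im (hermitian_inner x x) = 0"
proof -
  have "hermitian_inner x x = complex_of_real (\<Sum>k\<in>UNIV. (norm (x $ k))\<^sup>2)"
    by (simp add: hermitian_inner_def flip: complex_norm_square)
  then show "norm x = sqrt (Re (hermitian_inner x x))"
    and "Im (hermitian_inner x x) = 0"
    by (simp_all add: norm_vec_def L2_set_def)
qed

definition vec_mean :: "complex ^ 'n \<Rightarrow> complex" where
  "vec_mean x = (1 / of_nat CARD('n)) * (\<Sum>k\<in>UNIV. x $ k)"

definition affine_deviation :: "complex ^ 'n \<Rightarrow> complex ^ 'n \<Rightarrow> real" where
  "affine_deviation x y = Inf {dist (a *s x + vec b) y | a b. a \<noteq> 0}"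

end

theory Submission
  imports Defs
begin

text \<open>
  Write \<open>u = x - x\<^sub>0\<close> and \<open>v = y - y\<^sub>0\<close>. Both are orthogonal to the constant vectors, and
  \<open>a *s x + vec b - y\<close> is \<open>a *s u - v\<close> plus a constant vector. By Pythagoras it is at least as
  long as \<open>a *s u - v\<close>, with equality for the translation \<open>b = y\<^sub>0 - a * x\<^sub>0\<close>. So the affine
  deviation is the infimum of \<open>norm (a *s u - v)\<close> over the scalars \<open>a \<noteq> 0\<close>.

  This expression is continuous in \<open>a\<close>, so omitting the single scalar \<open>0\<close> does not change the
  infimum, which is therefore the value at any minimiser among all complex scalars
  (\<open>affine_deviation_eq_minimum\<close>). This matters when \<open>u \<noteq> 0\<close> and \<open>v\<close> are
  orthogonal: the infimum is then the value at \<open>0\<close> and is not attained.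

  If \<open>x\<close> is constant, then \<open>u = 0\<close> and every scalar is a minimiser. Otherwise the minimiser is
  the coefficient of the orthogonal projection of \<open>v\<close> onto the line spanned by \<open>u\<close>, and two more
  uses of Pythagoras prove that it is one and give the closed form of the minimum.
\<close>

lemma hermitian_inner_smult_left: "hermitian_inner (a *s x) y = a * hermitian_inner x y"
  by (simp add: hermitian_inner_def sum_distrib_left mult.assoc)

lemma hermitian_inner_smult_right: "hermitian_inner x (a *s y) = cnj a * hermitian_inner x y"
  by (simp add: hermitian_inner_def sum_distrib_left mult.left_commute)

lemma hermitian_inner_diff_right:
  "hermitian_inner x (y - z) = hermitian_inner x y - hermitian_inner x z"
  by (simp add: hermitian_inner_def sum_subtractf algebra_simps)

lemma hermitian_inner_self: "hermitian_inner x x = complex_of_real ((norm x)\<^sup>2)"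
  by (simp add: hermitian_inner_def norm_vec_def L2_set_def sum_nonneg complex_norm_square
      del: of_real_power)

lemma norm_smult_complex: "norm (a *s x) = cmod a * norm (x :: complex ^ 'n)"
  by (simp add: norm_vec_def L2_set_def norm_mult power_mult_distrib real_sqrt_mult
      flip: sum_distrib_left)

lemma inner_eq_Re_hermitian_inner: "x \<bullet> y = Re (hermitian_inner x y)"
  by (simp add: hermitian_inner_def inner_vec_def inner_complex_def)

lemma hermitian_Pythagoras:
  assumes "hermitian_inner x y = 0"
  shows "(norm (x + y))\<^sup>2 = (norm x)\<^sup>2 + (norm y)\<^sup>2"
  using assms
  by (intro norm_add_Pythagorean) (simp add: orthogonal_def inner_eq_Re_hermitian_inner)

lemma hermitian_inner_vec_centred: "hermitian_inner (vec c) (x - vec (vec_mean x)) = 0"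
  by (simp add: hermitian_inner_def vec_mean_def sum_subtractf flip: sum_distrib_left cnj_sum)

lemma is_constant_iff: "is_constant x \<longleftrightarrow> x - vec (vec_mean x) = 0"
proof
  assume const: "is_constant x"
  have "vec_mean x = x $ i" for i
  proof -
    have "(\<Sum>k\<in>UNIV. x $ k) = (\<Sum>k\<in>(UNIV :: 'a set). x $ i)"
      using const unfolding is_constant_def by (intro sum.cong) auto
    then show ?thesis by (simp add: vec_mean_def)
  qed
  then show "x - vec (vec_mean x) = 0" by (simp add: vec_eq_iff)
qed (simp add: is_constant_def vec_eq_iff)

text \<open>
  For a fixed scalar, the best translation is the one that matches the means: any other one adds
  a constant vector, which is orthogonal to the centred difference and can only lengthen it.
\<close>

lemma norm_centred_le_dist:
  "norm (a *s (x - vec (vec_mean x)) - (y - vec (vec_mean y))) \<le> dist (a *s x + vec b) y"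
proof -
  define w where "w = a *s (x - vec (vec_mean x)) - (y - vec (vec_mean y))"
  define c where "c = a * vec_mean x + b - vec_mean y"
  have "a *s x + vec b - y = vec c + w"
    by (simp add: vec_eq_iff w_def c_def algebra_simps)
  moreover have "hermitian_inner (vec c) w = 0"
    by (simp only: w_def hermitian_inner_diff_right[of _ "a *s _"] hermitian_inner_smult_right
        hermitian_inner_vec_centred) simp
  ultimately have "(norm w)\<^sup>2 \<le> (dist (a *s x + vec b) y)\<^sup>2"
    by (simp add: dist_norm hermitian_Pythagoras)
  then show ?thesis
    unfolding w_def by (rule power2_le_imp_le) simp
qed

lemma dist_matching_means:
  "dist (a *s x + vec (vec_mean y - a * vec_mean x)) y =
    norm (a *s (x - vec (vec_mean x)) - (y - vec (vec_mean y)))"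
  unfolding dist_norm by (rule arg_cong[of _ _ norm]) (simp add: vec_eq_iff algebra_simps)

text \<open>
  The minimiser \<open>a'\<close> may be \<open>0\<close>, although the infimum runs over \<open>a \<noteq> 0\<close> only: the value there is
  a limit of values at nonzero scalars, hence not below the infimum.
\<close>

lemma affine_deviation_eq_minimum:
  fixes x y :: "complex ^ 'n"
  defines "f \<equiv> \<lambda>a. norm (a *s (x - vec (vec_mean x)) - (y - vec (vec_mean y)))"
  assumes min: "\<And>a. f a' \<le> f a"
  shows "affine_deviation x y = f a'"
proof -
  define S where "S = {dist (a *s x + vec b) y | a b. a \<noteq> 0}"
  have in_S: "f a \<in> S" if "a \<noteq> 0" for a
    unfolding S_def mem_Collect_eq f_def
    by (intro exI conjI, rule dist_matching_means[symmetric], rule that)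
  have lower: "f a' \<le> s" if s: "s \<in> S" for s
  proof -
    obtain a b where "s = dist (a *s x + vec b) y"
      using s unfolding S_def by blast
    then have "f a \<le> s"
      unfolding f_def by (simp only: norm_centred_le_dist)
    with min show ?thesis by (rule order_trans)
  qed
  have "bdd_below S" using lower by (rule bdd_belowI)
  then have "Inf S \<le> f a" if "a \<noteq> 0" for a
    using in_S[OF that] by (rule cInf_lower[rotated])
  then have "\<forall>\<^sub>F a in at a'. Inf S \<le> f a"
    using eventually_neq_at_within[of 0 a' UNIV] by (auto elim: eventually_mono)
  moreover have "((\<lambda>a. a *s u) \<longlongrightarrow> a' *s u) (at a')" for u :: "complex ^ 'n"
    by (rule vec_tendstoI) (simp, intro tendsto_intros)
  then have "(f \<longlongrightarrow> f a') (at a')"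
    unfolding f_def by (intro tendsto_norm tendsto_diff[OF _ tendsto_const])
  ultimately have "Inf S \<le> f a'"
    by (intro tendsto_lowerbound) auto
  moreover have "f a' \<le> Inf S"
    using in_S[of 1] lower by (intro cInf_greatest) auto
  ultimately show ?thesis
    unfolding affine_deviation_def S_def[symmetric] by simp
qed

text \<open>
  The residual of the projection of \<open>v\<close> onto the line through \<open>u\<close> is orthogonal to \<open>u\<close>. Pythagoras
  splits \<open>a *s u - v\<close> into a multiple of \<open>u\<close> and the residual, and \<open>v\<close> into its projection and
  the residual.
\<close>

lemma projection_onto_line:
  fixes u v :: "complex ^ 'n"
  assumes "u \<noteq> 0"
  defines "a' \<equiv> cnj (hermitian_inner u v) / complex_of_real ((norm u)\<^sup>2)"
  shows projection_onto_line_minimal: "norm (a' *s u - v) \<le> norm (a *s u - v)"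
    and norm_projection_residual:
      "norm (a' *s u - v) = sqrt ((norm v)\<^sup>2 - (cmod (hermitian_inner u v))\<^sup>2 / (norm u)\<^sup>2)"
proof -
  have orth: "hermitian_inner u (a' *s u - v) = 0"
    using assms(1) by (simp add: a'_def hermitian_inner_diff_right hermitian_inner_smult_right
        hermitian_inner_self)
  have split: "(norm (b *s u + (a' *s u - v)))\<^sup>2 = (cmod b * norm u)\<^sup>2 + (norm (a' *s u - v))\<^sup>2"
    for b
    by (subst hermitian_Pythagoras)
      (simp_all add: hermitian_inner_smult_left orth norm_smult_complex)
  have "(a - a') *s u + (a' *s u - v) = a *s u - v"
    by (simp add: vec_eq_iff algebra_simps)
  with split[of "a - a'"] have "(norm (a' *s u - v))\<^sup>2 \<le> (norm (a *s u - v))\<^sup>2"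
    by simp
  then show "norm (a' *s u - v) \<le> norm (a *s u - v)"
    by (rule power2_le_imp_le) simp
  have "(- a') *s u + (a' *s u - v) = - v"
    by (simp add: vec_eq_iff algebra_simps)
  with split[of "- a'"] have "(norm v)\<^sup>2 = (cmod a' * norm u)\<^sup>2 + (norm (a' *s u - v))\<^sup>2"
    by simp
  moreover have "(cmod a' * norm u)\<^sup>2 = (cmod (hermitian_inner u v))\<^sup>2 / (norm u)\<^sup>2"
  proof -
    have "cmod a' = cmod (hermitian_inner u v) / (norm u)\<^sup>2"
      by (simp add: a'_def norm_divide flip: of_real_power)
    then have "cmod a' * norm u = cmod (hermitian_inner u v) / norm u"
      using assms(1) by (simp add: power2_eq_square)
    then show ?thesis by (simp only: power_divide)
  qed
  ultimately show
    "norm (a' *s u - v) = sqrt ((norm v)\<^sup>2 - (cmod (hermitian_inner u v))\<^sup>2 / (norm u)\<^sup>2)"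
    by (intro real_sqrt_unique[symmetric]) simp_all
qed

theorem theorem4:
  fixes x y :: "complex ^ 'n" and x0 y0 :: complex
  assumes x0: "x0 = vec_mean x" and y0: "y0 = vec_mean y"
  shows "(\<not> is_constant x \<longrightarrow>
      affine_deviation x y =
        sqrt ((norm (y - vec y0))\<^sup>2 -
          (cmod (hermitian_inner (x - vec x0) (y - vec y0)))\<^sup>2 / (norm (x - vec x0))\<^sup>2) \<and>
      affine_deviation x y =
        dist ((cnj (hermitian_inner (x - vec x0) (y - vec y0)) /
               complex_of_real ((norm (x - vec x0))\<^sup>2)) *s (x - vec x0))
             (y - vec y0)) \<and>
    (is_constant x \<longrightarrow> affine_deviation x y = norm (y - vec y0))"
proof (intro conjI[of "_ \<longrightarrow> _"] impI)
  define u v where "u = x - vec x0" and "v = y - vec y0"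
  note uv = u_def v_def x0 y0
  {
    assume "\<not> is_constant x"
    then have "u \<noteq> 0" by (simp add: is_constant_iff uv)
    let ?a = "cnj (hermitian_inner u v) / complex_of_real ((norm u)\<^sup>2)"
    have "affine_deviation x y = norm (?a *s u - v)"
      using affine_deviation_eq_minimum[where x = x and y = y and a' = ?a]
        projection_onto_line_minimal[OF \<open>u \<noteq> 0\<close>, of v] by (simp only: uv)
    then show "affine_deviation x y =
        sqrt ((norm (y - vec y0))\<^sup>2 -
          (cmod (hermitian_inner (x - vec x0) (y - vec y0)))\<^sup>2 / (norm (x - vec x0))\<^sup>2) \<and>
      affine_deviation x y =
        dist ((cnj (hermitian_inner (x - vec x0) (y - vec y0)) /
               complex_of_real ((norm (x - vec x0))\<^sup>2)) *s (x - vec x0))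
             (y - vec y0)"
      using norm_projection_residual[OF \<open>u \<noteq> 0\<close>, of v]
      unfolding u_def v_def dist_norm by simp
  next
    assume "is_constant x"
    then have "x - vec (vec_mean x) = 0" by (simp add: is_constant_iff)
    then show "affine_deviation x y = norm (y - vec y0)"
      using affine_deviation_eq_minimum[where x = x and y = y and a' = 0]
      by (simp add: y0 norm_minus_commute)
  }
qed

end
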